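(* Let $n\ge 2$ and let $P(e^{it})=\sum_{j=-n+1}^{n-1}c_je^{ijt}$ be a positive trigonometric polynomial (i.e. $P(e^{it})\ge 0$ for all $t\in\mathbb{R}$). Then, for all distinct numbers $k$ and $l$ in $\{0,\dots,n-1\}$, there exists $\gamma\in\mathbb{R}$ such that $$|c_k|+|c_l|\le c_0\,\omega_2(S_n^k+e^{i\gamma}S_n^l).$$ In particular, $$|c_k|+|c_l|\le c_0\left(1+\cos\frac{\pi}{\left[\frac{n-1}{k+l}\right]+2}\right)^{1/2}\left(1+\cos\frac{\pi}{\left[\frac{n-1}{|k-l|}\right]+2}\right)^{1/2}.$$
   Context: $[x]$ denotes the integer part of $x$ (greatest integer not exceeding $x$). $S_n^*$ is the $n\times n$ nilpotent Jordan cell on $\mathbb{C}^n$ with ones on the first superdiagonal and zeros elsewhere, and $S_n$ is its adjoint. For an operator $A$ on a Hilbert space $H$, $\omega_2(A)=\sup\{|\langle Ax\mid x\rangle|:x\in H,\|x\|=1\}$ is the numerical radius. *)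

theory Defs
  imports "HOL-Analysis.Analysis" "Jordan_Normal_Form.Jordan_Normal_Form"
    "Jordan_Normal_Form.Schur_Decomposition"
begin

(* jordan_block n 0 has ones on the first superdiagonal, so it is the cell called S_n^* in the
   paper; S_n itself is the adjoint, with ones on the first subdiagonal. *)
definition shift_mat :: "nat \<Rightarrow> complex mat" where
  "shift_mat n = mat_adjoint (jordan_block n 0)"

(* The numerical radius of the operator v \<mapsto> A v on the Hilbert space C^n, for a square
   matrix A of size n; v \<bullet>c w is linear in v and conjugate-linear in w, so v \<bullet>c v is the
   squared Euclidean norm. The supremum is over a bounded set, nonempty as soon as n > 0. *)
definition numerical_radius :: "complex mat \<Rightarrow> real" where
  "numerical_radius A =
     (SUP v \<in> {v \<in> carrier_vec (dim_row A). v \<bullet>c v = 1}. cmod ((A *\<^sub>v v) \<bullet>c v))"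

definition trig_poly :: "nat \<Rightarrow> (int \<Rightarrow> complex) \<Rightarrow> complex \<Rightarrow> complex" where
  "trig_poly n c z = (\<Sum>j = - int n + 1..int n - 1. c j * z powi j)"

(* The order on complex: 0 \<le> z means that z is real and nonnegative. *)
definition positive_trig_poly :: "nat \<Rightarrow> (int \<Rightarrow> complex) \<Rightarrow> bool" where
  "positive_trig_poly n c \<longleftrightarrow> (\<forall>t::real. 0 \<le> trig_poly n c (exp (\<i> * of_real t)))"

end

theory Submission
  imports Defs
begin

(* By Fejer-Riesz, P = |Q|^2 on the circle; with v the vector of conjugated coefficients of Q one has
   <S_n^k v | v> = c_k and |v|^2 = c_0, and gamma is chosen to align the arguments of c_k and
   c_l. Fejer-Riesz is needed only for strictly positive P (no zeros on the circle), since gamma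
   does not change when a constant e > 0 is added to P, and then e tends to 0.

   For the explicit bound, write c_m as an average of P over sufficiently many equidistant nodes.
   The identity cos x + cos y = 2 cos ((x + y) / 2) cos ((x - y) / 2) and Cauchy-Schwarz give
   (|c_k| + |c_l|)^2 <= (c_0 + |c_{k+l}|) (c_0 + |c_{k-l}|), and the Egervary-Szasz inequality
   |c_m| <= c_0 cos (pi / ([(n-1)/m] + 2)) follows by placing the nodes so that the arguments of
   the weights avoid a neighbourhood of 0. *)

unbundle no vec_syntax

subsection \<open>Sampling at equidistant nodes\<close>

text \<open>Discrete orthogonality: apart from a constant phase the summands are the powers of the
  root of unity \<open>w\<close>, and their geometric sum vanishes unless \<open>w = 1\<close>. The
  offset \<theta> stays free because the Egervary-Szasz bound needs shifted nodes.\<close>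

lemma sum_cis_nodes:
  fixes N :: nat and j :: int
  assumes "N > 0"
  shows "(\<Sum>s<N. cis (of_int j * (\<theta> + 2 * pi * real s / real N)))
           = (if int N dvd j then of_nat N * cis (of_int j * \<theta>) else 0)"
proof -
  define w where "w = cis (2 * pi * of_int j / real N)"
  have power: "cis (of_int j * (\<theta> + 2 * pi * real s / real N)) = cis (of_int j * \<theta>) * w ^ s" for s
    unfolding w_def Complex.DeMoivre cis_mult by (rule arg_cong[where f = cis]) (simp add: field_simps)
  have wN: "w ^ N = 1"
    unfolding w_def Complex.DeMoivre using assms cis_multiple_2pi[of "of_int j"] by (simp add: mult_ac)
  have w1: "w = 1 \<longleftrightarrow> int N dvd j"
  proof
    assume "w = 1"
    hence "cos (2 * pi * of_int j / real N) = 1"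
      unfolding w_def by (metis cis.sel(1) one_complex.sel(1))
    then obtain x :: int where "2 * pi * of_int j / real N = of_int x * 2 * pi"
      using cos_one_2pi_int by auto
    hence "real_of_int j = of_int (x * int N)" using assms by (simp add: field_simps)
    hence "j = x * int N" by (simp only: of_int_eq_iff)
    thus "int N dvd j" by simp
  next
    assume "int N dvd j"
    then obtain x where "j = int N * x" ..
    thus "w = 1" unfolding w_def using assms cis_multiple_2pi[of "of_int x"] by (simp add: mult.assoc)
  qed
  show ?thesis
    unfolding power sum_distrib_left[symmetric]
    using wN w1 geometric_sum[of w N] by (cases "w = 1") auto
qed

lemma trig_poly_cis: "trig_poly n c (cis t) = (\<Sum>j = - int n + 1..int n - 1. c j * cis (of_int j * t))"
  unfolding trig_poly_def by (simp add: cis_power_int)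

text \<open>The second hypothesis excludes aliasing: no frequency in the support other than
  \<open>m\<close> itself is congruent to \<open>m\<close> modulo \<open>N\<close>. A frequency
  \<open>m\<close> outside the support is allowed and yields 0, which matters later for
  \<open>k + l >= n\<close>.\<close>

lemma trig_poly_nodes:
  fixes N :: nat and m :: int
  assumes "N > 0" and "\<And>j. \<bar>j\<bar> < int n \<Longrightarrow> int N dvd j - m \<Longrightarrow> j = m"
  shows "(\<Sum>s<N. trig_poly n c (cis (\<theta> + 2 * pi * real s / real N))
                   * cis (- (of_int m * (\<theta> + 2 * pi * real s / real N))))
           = of_nat N * (if \<bar>m\<bar> < int n then c m else 0)"
proof -
  let ?J = "{- int n + 1..int n - 1}"
  let ?t = "\<lambda>s. \<theta> + 2 * pi * real s / real N"
  have J: "j \<in> ?J \<longleftrightarrow> \<bar>j\<bar> < int n" for j by auto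
  have "(\<Sum>s<N. trig_poly n c (cis (?t s)) * cis (- (of_int m * ?t s)))
      = (\<Sum>s<N. \<Sum>j\<in>?J. c j * cis (of_int (j - m) * ?t s))"
    unfolding trig_poly_cis sum_distrib_right mult.assoc cis_mult
    by (simp add: left_diff_distrib)
  also have "\<dots> = (\<Sum>j\<in>?J. c j * (\<Sum>s<N. cis (of_int (j - m) * ?t s)))"
    by (subst sum.swap) (simp add: sum_distrib_left)
  also have "\<dots> = (\<Sum>j\<in>?J. if j = m then of_nat N * c m else 0)"
    unfolding sum_cis_nodes[OF assms(1)] using assms(2) J by (intro sum.cong) auto
  also have "\<dots> = of_nat N * (if \<bar>m\<bar> < int n then c m else 0)"
    using J[of m] by (simp add: sum.delta)
  finally show ?thesis .
qed

text \<open>Modulo 2 pi the angle lies between pi/N and 2 pi - pi/N, because an odd multiple of pi/N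
  keeps at least that distance from every multiple of 2 pi.\<close>

lemma cos_odd_multiple_le:
  fixes N s :: nat
  assumes "N \<ge> 2"
  shows "cos ((2 * real s + 1) * pi / real N) \<le> cos (pi / real N)"
proof -
  define r where "r = s mod N"
  define u where "u = (2 * real r + 1) * pi / real N"
  have r: "r < N" using assms by (simp add: r_def)
  have "real s = real N * real (s div N) + real r"
    unfolding r_def of_nat_mult[symmetric] of_nat_add[symmetric] by simp
  hence "(2 * real s + 1) * pi / real N = u + 2 * real (s div N) * pi"
    using assms by (simp add: u_def field_simps)
  moreover have "cos (2 * real (s div N) * pi) = 1" "sin (2 * real (s div N) * pi) = 0"
    using cos_2npi sin_2npi by auto
  ultimately have cu: "cos ((2 * real s + 1) * pi / real N) = cos u"
    by (simp add: cos_add)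
  have lo: "pi / real N \<le> u" unfolding u_def by (simp add: divide_right_mono)
  have "2 * real r + 2 \<le> 2 * real N" using r by linarith
  hence "(2 * real r + 2) * pi \<le> (2 * real N) * pi" by (intro mult_right_mono) auto
  hence hi: "pi / real N \<le> 2 * pi - u" using assms unfolding u_def by (simp add: field_simps)
  show ?thesis
  proof (cases "u \<le> pi")
    case True
    thus ?thesis unfolding cu using lo by (intro cos_monotone_0_pi_le) auto
  next
    case False
    have "cos (2 * pi - u) \<le> cos (pi / real N)"
      using hi False by (intro cos_monotone_0_pi_le) auto
    thus ?thesis unfolding cu by (simp add: cos_diff)
  qed
qed

section \<open>Coefficient bounds for positive trigonometric polynomials\<close>

lemma positive_trig_poly_cis:
  assumes "positive_trig_poly n c"
  shows "trig_poly n c (cis t) = of_real (Re (trig_poly n c (cis t)))" "0 \<le> Re (trig_poly n c (cis t))"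
  using assms unfolding positive_trig_poly_def cis_conv_exp
  by (auto simp: less_eq_complex_def complex_eq_iff)

text \<open>Real form of the quadrature, with the values of P as nonnegative weights. Taking
  \<alpha> to be the argument of the coefficient turns the right side into its modulus.\<close>

lemma positive_trig_poly_nodes:
  fixes N m :: nat
  assumes "positive_trig_poly n c" and "N > 0"
    and "\<And>j. \<bar>j\<bar> < int n \<Longrightarrow> int N dvd j - int m \<Longrightarrow> j = int m"
  shows "(\<Sum>s<N. Re (trig_poly n c (cis (\<theta> + 2 * pi * real s / real N)))
                   * cos (\<alpha> + real m * (\<theta> + 2 * pi * real s / real N)))
           = real N * Re (cis (- \<alpha>) * (if m < n then c (int m) else 0))"
proof -
  let ?t = "\<lambda>s. \<theta> + 2 * pi * real s / real N"
  have "real N * Re (cis (- \<alpha>) * (if m < n then c (int m) else 0))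
      = Re (cis (- \<alpha>) * (of_nat N * (if \<bar>int m\<bar> < int n then c (int m) else 0)))"
    by (simp add: algebra_simps)
  also have "\<dots> = (\<Sum>s<N. Re (cis (- \<alpha>) *
      (trig_poly n c (cis (?t s)) * cis (- (of_int (int m) * ?t s)))))"
    by (subst trig_poly_nodes[OF assms(2,3), where c = c and \<theta> = \<theta>, symmetric])
      (simp_all only: sum_distrib_left Re_sum)
  also have "\<dots> = (\<Sum>s<N. Re (trig_poly n c (cis (?t s))) * cos (\<alpha> + real m * ?t s))"
  proof (intro sum.cong refl)
    fix s
    have "cis (- \<alpha>) * (trig_poly n c (cis (?t s)) * cis (- (of_int (int m) * ?t s)))
        = of_real (Re (trig_poly n c (cis (?t s)))) * cis (- (\<alpha> + real m * ?t s))"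
      by (subst positive_trig_poly_cis(1)[OF assms(1)])
         (simp only: mult.left_commute[of "cis (- \<alpha>)"] cis_mult minus_add_distrib of_int_of_nat_eq)
    thus "Re (cis (- \<alpha>) * (trig_poly n c (cis (?t s)) * cis (- (of_int (int m) * ?t s))))
        = Re (trig_poly n c (cis (?t s))) * cos (\<alpha> + real m * ?t s)"
      by (simp del: mult_minus_left minus_add_distrib)
  qed
  finally show ?thesis by (rule sym)
qed

lemma cis_minus_Arg: "cis (- Arg z) * z = of_real (cmod z)"
proof -
  have "z = of_real (cmod z) * cis (Arg z)" using rcis_cmod_Arg[of z] by (simp add: rcis_def)
  hence "cis (- Arg z) * z = of_real (cmod z) * (cis (- Arg z) * cis (Arg z))"
    by (metis mult.left_commute)
  thus ?thesis by (simp add: cis_mult)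
qed

text \<open>Enough nodes rule out aliasing: |j - m| < n + m <= N leaves 0 as the only possible
  multiple of \<open>N\<close>.\<close>

lemma node_residue_unique:
  fixes j m :: int
  assumes "int N dvd j - m" "\<bar>j\<bar> < int n" "0 \<le> m" "int n + m \<le> int N"
  shows "j = m"
proof (rule ccontr)
  assume "j \<noteq> m"
  hence "int N \<le> \<bar>j - m\<bar>" using assms(1) zdvd_imp_le[of "int N" "\<bar>j - m\<bar>"] by auto
  thus False using assms by linarith
qed

text \<open>The coefficient c_0 is the mean of P over the nodes. This is what makes
  \<open>Re (c 0)\<close> a faithful rendering of c_0 in the bounds.\<close>

lemma positive_trig_poly_coeff_0:
  assumes "positive_trig_poly n c" "n > 0"
  shows "c 0 = of_real (Re (c 0))" "0 \<le> Re (c 0)"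
proof -
  let ?t = "\<lambda>s. 0 + 2 * pi * real s / real n"
  have "complex_of_nat n * c 0 = (\<Sum>s<n. trig_poly n c (cis (?t s)) * cis (- (of_int 0 * ?t s)))"
    using assms(2) by (subst trig_poly_nodes) (auto intro: node_residue_unique)
  also have "\<dots> = of_real (\<Sum>s<n. Re (trig_poly n c (cis (?t s))))"
    by (simp flip: positive_trig_poly_cis(1)[OF assms(1)])
  finally have *: "complex_of_nat n * c 0 = of_real (\<Sum>s<n. Re (trig_poly n c (cis (?t s))))" .
  from arg_cong[OF *, of Im] show "c 0 = of_real (Re (c 0))"
    using assms(2) by (simp add: complex_eq_iff)
  have "real n * Re (c 0) = (\<Sum>s<n. Re (trig_poly n c (cis (?t s))))"
    using arg_cong[OF *, of Re] by simp
  also have "\<dots> \<ge> 0" by (intro sum_nonneg positive_trig_poly_cis(2) assms)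
  finally show "0 \<le> Re (c 0)" using assms(2) by (simp add: zero_le_mult_iff)
qed

text \<open>The same \<open>N\<close> nodes compute both c_m, against a cosine bounded by cos
  (pi/M), and c_0, the total weight. The conditional covers \<open>m >= n\<close>, where
  \<open>M = 2\<close> and the bound is 0.\<close>

lemma egervary_szasz:
  fixes n m :: nat
  assumes pos: "positive_trig_poly n c" and n: "n > 0" and m: "m > 0"
  shows "cmod (if m < n then c (int m) else 0) \<le> Re (c 0) * cos (pi / (real ((n - 1) div m) + 2))"
proof -
  define z where "z = (if m < n then c (int m) else 0)"
  \<comment> \<open>This is the least \<open>M\<close> with m * M >= n + m, so \<open>N\<close> is
    the smallest multiple of \<open>m\<close> to which \<open>node_residue_unique\<close>
    applies.\<close>
  define M where "M = (n - 1) div m + 2"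
  define N where "N = m * M"
  \<comment> \<open>The offset solves Arg z + m * \<theta> = pi/M; each further node adds 2 pi/M, so
    only odd multiples of pi/M occur.\<close>
  define \<theta> where "\<theta> = (pi / real M - Arg z) / real m"
  let ?t = "\<lambda>s. \<theta> + 2 * pi * real s / real N"
  let ?P = "\<lambda>s. Re (trig_poly n c (cis (?t s)))"
  have M: "M \<ge> 2" by (simp add: M_def)
  have "(n - 1) mod m < m" using m by simp
  hence "n - 1 < m * ((n - 1) div m) + m"
    using mult_div_mod_eq[of m "n - 1"] by linarith
  hence "n + m \<le> N" by (simp add: N_def M_def algebra_simps)
  hence res: "j = int i" if "\<bar>j\<bar> < int n" "int N dvd j - int i" "i \<le> m" for j i
    using that by (intro node_residue_unique[of N j "int i" n]) auto
  have N: "N > 0" using m M by (simp add: N_def)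
  have "real N * cmod z = real N * Re (cis (- Arg z) * z)"
    by (simp add: cis_minus_Arg del: times_complex.sel)
  also have "\<dots> = (\<Sum>s<N. ?P s * cos (Arg z + real m * ?t s))"
    unfolding z_def by (rule positive_trig_poly_nodes[OF pos N, symmetric]) (use res in auto)
  also have "\<dots> = (\<Sum>s<N. ?P s * cos ((2 * real s + 1) * pi / real M))"
  proof (intro sum.cong refl arg_cong2[where f = "(*)"] arg_cong[where f = cos])
    fix s show "Arg z + real m * ?t s = (2 * real s + 1) * pi / real M"
      using m M by (simp add: \<theta>_def N_def field_simps)
  qed
  also have "\<dots> \<le> (\<Sum>s<N. ?P s * cos (pi / real M))"
    by (intro sum_mono mult_left_mono cos_odd_multiple_le M positive_trig_poly_cis(2)[OF pos])
  also have "\<dots> = (\<Sum>s<N. ?P s * cos (0 + real 0 * ?t s)) * cos (pi / real M)"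
    by (simp add: sum_distrib_right)
  also have "\<dots> = real N * Re (c 0) * cos (pi / real M)"
    using n by (subst positive_trig_poly_nodes[OF pos N]) (use res[where i = 0] in auto)
  finally have "real N * cmod z \<le> real N * (Re (c 0) * cos (pi / real M))" by (simp add: mult.assoc)
  hence "cmod z \<le> Re (c 0) * cos (pi / real M)" using N by simp
  thus ?thesis by (simp add: z_def M_def algebra_simps)
qed

lemma positive_trig_poly_two_coeffs:
  fixes n k l :: nat
  assumes pos: "positive_trig_poly n c" and lk: "l < k" and kn: "k < n"
  shows "cmod (c (int k)) + cmod (c (int l))
           \<le> Re (c 0) * sqrt (1 + cos (pi / (real ((n - 1) div (k + l)) + 2)))
                      * sqrt (1 + cos (pi / (real ((n - 1) div (k - l)) + 2)))"
proof -
  \<comment> \<open>Frequencies up to k + l <= 2n are sampled, so 3n nodes would suffice for n + m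
    <= N.\<close>
  define N where "N = 4 * n"
  define a b where "a = Arg (c (int k))" and "b = Arg (c (int l))"
  define x where "x = (\<lambda>m. 1 + cos (pi / (real ((n - 1) div m) + 2)))"
  let ?t = "\<lambda>s. 0 + 2 * pi * real s / real N"
  let ?P = "\<lambda>s. Re (trig_poly n c (cis (?t s)))"
  \<comment> \<open>The half sum and half difference of the two phases a + k t and b + l t, as they
    arise from the sum-to-product formula.\<close>
  define u where "u = (\<lambda>s. cos ((a + b + real (k + l) * ?t s) / 2))"
  define v where "v = (\<lambda>s. cos ((a - b + real (k - l) * ?t s) / 2))"
  have n: "n > 0" and N: "N > 0" using kn by (auto simp: N_def)
  have P: "?P s \<ge> 0" for s by (rule positive_trig_poly_cis(2)[OF pos])
  have nodes: "(\<Sum>s<N. ?P s * cos (\<alpha> + real m * ?t s))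
      = real N * Re (cis (- \<alpha>) * (if m < n then c (int m) else 0))" if "m \<le> 2 * n" for m \<alpha>
    by (rule positive_trig_poly_nodes[OF pos N])
       (rule node_residue_unique[of N _ _ n], use that in \<open>auto simp: N_def\<close>)
  \<comment> \<open>Since 2 cos^2 (y/2) = 1 + cos y, the weighted square sum only involves c_0 and
    c_m, and the latter is bounded by \<open>egervary_szasz\<close>.\<close>
  have square: "2 * (\<Sum>s<N. ?P s * (cos ((\<alpha> + real m * ?t s) / 2))\<^sup>2) \<le> real N * (Re (c 0) * x m)"
    if "m > 0" "m \<le> 2 * n" for m \<alpha>
  proof -
    have "2 * (\<Sum>s<N. ?P s * (cos ((\<alpha> + real m * ?t s) / 2))\<^sup>2)
        = (\<Sum>s<N. ?P s * cos (0 + real 0 * ?t s)) + (\<Sum>s<N. ?P s * cos (\<alpha> + real m * ?t s))"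
    proof -
      have "2 * (cos (y / 2))\<^sup>2 = 1 + cos y" for y :: real
        using cos_double_cos[of "y / 2"] by simp
      hence "2 * (?P s * (cos ((\<alpha> + real m * ?t s) / 2))\<^sup>2)
          = ?P s * cos (0 + real 0 * ?t s) + ?P s * cos (\<alpha> + real m * ?t s)" for s
        by (simp add: mult.left_commute[of 2] distrib_left)
      thus ?thesis by (simp add: sum_distrib_left sum.distrib)
    qed
    also have "\<dots> = real N * (Re (c 0) + Re (cis (- \<alpha>) * (if m < n then c (int m) else 0)))"
      using nodes[of 0 0] nodes[OF that(2), of \<alpha>] n by (simp add: algebra_simps)
    also have "\<dots> \<le> real N * (Re (c 0) + Re (c 0) * cos (pi / (real ((n - 1) div m) + 2)))"
      using complex_Re_le_cmod[of "cis (- \<alpha>) * (if m < n then c (int m) else 0)"]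
        egervary_szasz[OF pos n that(1)]
      by (intro mult_left_mono add_left_mono) (auto simp: norm_mult simp del: times_complex.sel)
    finally show ?thesis by (simp add: x_def distrib_left)
  qed
  have "real N * (cmod (c (int k)) + cmod (c (int l)))
      = real N * Re (cis (- a) * c (int k)) + real N * Re (cis (- b) * c (int l))"
    unfolding a_def b_def cis_minus_Arg by (simp add: distrib_left)
  also have "\<dots> = (\<Sum>s<N. ?P s * (cos (a + real k * ?t s) + cos (b + real l * ?t s)))"
    using nodes[of k a] nodes[of l b] lk kn by (simp add: distrib_left sum.distrib del: times_complex.sel)
  \<comment> \<open>The weight P is split evenly between the two factors in preparation for
    Cauchy-Schwarz.\<close>
  also have "\<dots> = 2 * (\<Sum>s<N. (sqrt (?P s) * u s) * (sqrt (?P s) * v s))"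
  proof -
    have "?P s * (cos (a + real k * ?t s) + cos (b + real l * ?t s))
        = 2 * ((sqrt (?P s) * u s) * (sqrt (?P s) * v s))" for s
    proof -
      have "cos (a + real k * ?t s) + cos (b + real l * ?t s) = 2 * u s * v s"
      proof -
        have "(a + real k * y + (b + real l * y)) / 2 = (a + b + real (k + l) * y) / 2"
          "(a + real k * y - (b + real l * y)) / 2 = (a - b + real (k - l) * y) / 2" for y
          using lk by (simp_all add: of_nat_diff algebra_simps)
        thus ?thesis unfolding cos_plus_cos u_def v_def by (simp only: mult.assoc)
      qed
      moreover have "sqrt (?P s) * sqrt (?P s) = ?P s" using P[of s] by simp
      moreover have "2 * ((x * y) * (x * z)) = (x * x) * (2 * y * z)" for x y z :: real by simp
      ultimately show ?thesis by (simp only:)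
    qed
    thus ?thesis by (simp only: sum_distrib_left)
  qed
  also have "\<dots> \<le> 2 * (sqrt (\<Sum>s<N. (sqrt (?P s) * u s)\<^sup>2) * sqrt (\<Sum>s<N. (sqrt (?P s) * v s)\<^sup>2))"
    unfolding real_sqrt_mult[symmetric]
    by (intro mult_left_mono real_le_rsqrt Cauchy_Schwarz_ineq_sum) simp
  also have "\<dots> = sqrt (2 * (\<Sum>s<N. ?P s * (u s)\<^sup>2)) * sqrt (2 * (\<Sum>s<N. ?P s * (v s)\<^sup>2))"
    using P by (simp add: power_mult_distrib real_sqrt_mult)
  also have "\<dots> \<le> sqrt (real N * (Re (c 0) * x (k + l))) * sqrt (real N * (Re (c 0) * x (k - l)))"
  proof (rule mult_mono')
    show "sqrt (2 * (\<Sum>s<N. ?P s * (u s)\<^sup>2)) \<le> sqrt (real N * (Re (c 0) * x (k + l)))"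
      unfolding u_def by (rule real_sqrt_le_mono, rule square) (use lk kn in auto)
    show "sqrt (2 * (\<Sum>s<N. ?P s * (v s)\<^sup>2)) \<le> sqrt (real N * (Re (c 0) * x (k - l)))"
      unfolding v_def by (rule real_sqrt_le_mono, rule square) (use lk kn in auto)
    show "0 \<le> sqrt (2 * (\<Sum>s<N. ?P s * (u s)\<^sup>2))" "0 \<le> sqrt (2 * (\<Sum>s<N. ?P s * (v s)\<^sup>2))"
      using P by (auto intro!: real_sqrt_ge_zero sum_nonneg mult_nonneg_nonneg)
  qed
  also have "\<dots> = real N * (Re (c 0) * sqrt (x (k + l)) * sqrt (x (k - l)))"
  proof -
    have "sqrt (real N * Re (c 0)) * sqrt (real N * Re (c 0)) = real N * Re (c 0)"
      using positive_trig_poly_coeff_0(2)[OF pos n] by simp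
    moreover have "sqrt (real N * (Re (c 0) * y)) = sqrt (real N * Re (c 0)) * sqrt y" for y
      by (simp add: real_sqrt_mult)
    moreover have "(w * y) * (w * z) = (w * w) * y * z" for w y z :: real by simp
    ultimately have "sqrt (real N * (Re (c 0) * x (k + l))) * sqrt (real N * (Re (c 0) * x (k - l)))
        = real N * Re (c 0) * sqrt (x (k + l)) * sqrt (x (k - l))"
      by (simp only:)
    thus ?thesis by (simp only: mult.assoc)
  qed
  finally show ?thesis using N by (simp add: x_def)
qed

subsection \<open>Fejer-Riesz factorization\<close>

lemma infinite_unit_circle: "infinite {z::complex. cmod z = 1}"
proof
  assume "finite {z::complex. cmod z = 1}"
  hence "finite (cis ` {0<..<pi})" by (rule rev_finite_subset) auto
  moreover have "inj_on cis {0<..<pi}"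
    by (intro inj_onI) (metis cis.sel(1) cos_inj_pi greaterThanLessThan_iff less_imp_le)
  ultimately have "finite {0<..<pi}" by (rule finite_imageD)
  thus False using infinite_Ioo[of 0 pi] by simp
qed

lemma poly_eq_on_unit_circle:
  fixes p q :: "complex poly"
  assumes "\<And>z. cmod z = 1 \<Longrightarrow> poly p z = poly q z"
  shows "p = q"
proof (rule ccontr)
  assume "p \<noteq> q"
  hence "finite {z. poly (p - q) z = 0}" by (intro poly_roots_finite) simp
  moreover have "{z. cmod z = 1} \<subseteq> {z. poly (p - q) z = 0}" using assms by auto
  ultimately show False using infinite_unit_circle finite_subset by blast
qed

text \<open>If p(z) / z^d is real on the circle, then p(z) = z^(2d) cnj (p(z)) there, and with cnj z
  = 1/z the right side is again a polynomial in z. As \<open>reflect_poly\<close> reverses with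
  respect to the actual degree, the monomial makes up the difference to 2d.\<close>

lemma self_inversive_poly:
  fixes p :: "complex poly"
  assumes deg: "degree p \<le> 2 * d"
    and real: "\<And>z. cmod z = 1 \<Longrightarrow> \<exists>\<rho>. poly p z = of_real \<rho> * z ^ d"
  shows "p = monom 1 (2 * d - degree p) * reflect_poly (map_poly cnj p)"
proof (rule poly_eq_on_unit_circle)
  fix z :: complex assume z: "cmod z = 1"
  hence z0: "z \<noteq> 0" and zz: "z * cnj z = 1" and zi: "inverse z = cnj z"
    by (auto simp: complex_norm_square[symmetric] divide_conv_cnj inverse_eq_divide)
  obtain \<rho> where \<rho>: "poly p z = of_real \<rho> * z ^ d" using real[OF z] by blast
  have dm: "degree (map_poly cnj p) = degree p" by (rule degree_map_poly) simp
  have "poly (monom 1 (2 * d - degree p) * reflect_poly (map_poly cnj p)) z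
      = z ^ (2 * d - degree p) * z ^ degree p * poly (map_poly cnj p) (cnj z)"
    by (simp add: poly_monom poly_reflect_poly_nz[OF z0] dm zi)
  also have "\<dots> = z ^ (2 * d) * cnj (poly p z)"
    unfolding poly_cnj power_add[symmetric] using deg by simp
  also have "\<dots> = of_real \<rho> * z ^ d * (z * cnj z) ^ d"
    unfolding \<rho> mult_2 power_add power_mult_distrib by (simp add: mult_ac)
  finally show "poly p z = poly (monom 1 (2 * d - degree p) * reflect_poly (map_poly cnj p)) z"
    by (simp add: \<rho> zz)
qed

text \<open>Each induction step splits off either a factor z or a pair of roots symmetric with
  respect to the circle. Strict positivity keeps roots off the circle, so the two roots of a pair
  are distinct.\<close>

lemma fejer_riesz_poly:
  fixes p :: "complex poly"
  assumes "degree p \<le> 2 * d"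
    and "\<And>z. cmod z = 1 \<Longrightarrow> \<exists>\<rho>>0. poly p z = of_real \<rho> * z ^ d"
  shows "\<exists>q. degree q \<le> d \<and> (\<forall>z. cmod z = 1 \<longrightarrow> poly p z = of_real ((cmod (poly q z))\<^sup>2) * z ^ d)"
  using assms
proof (induction d arbitrary: p)
  case 0
  from "0.prems"(1) obtain a where p: "p = [:a:]" by (auto elim: degree_eq_zeroE)
  from "0.prems"(2)[of 1] p obtain \<rho> where "\<rho> > 0" "a = of_real \<rho>" by auto
  thus ?case using p
    by (intro exI[of _ "[:of_real (sqrt \<rho>):]"]) (simp add: power2_eq_square flip: of_real_mult)
next
  case (Suc d)
  have p0: "p \<noteq> 0" using Suc.prems(2)[of 1] by auto
  have self: "p = monom 1 (2 * Suc d - degree p) * reflect_poly (map_poly cnj p)"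
    by (rule self_inversive_poly) (use Suc.prems in blast)+
  \<comment> \<open>Self-inversion links the two ends of p: the constant term vanishes exactly when
    the degree is below its maximum.\<close>
  have c0: "coeff p 0 = (if degree p = 2 * Suc d then cnj (lead_coeff p) else 0)"
    using Suc.prems(1) degree_map_poly[of cnj p]
    by (subst self) (auto simp: coeff_mult_0 coeff_map_poly)
  show ?case
  proof (cases "coeff p 0 = 0")
    case True
    have "degree p \<noteq> 2 * Suc d" using c0 True p0 by (metis complex_cnj_zero_iff leading_coeff_0_iff)
    from True obtain p1 where p1: "p = [:0, 1:] * p1"
      using poly_eq_0_iff_dvd[of p 0] by (auto simp: poly_0_coeff_0)
    hence "p1 \<noteq> 0" using p0 by auto
    hence "degree p = Suc (degree p1)" by (simp add: p1)
    \<comment> \<open>The degree drops by two relative to the bound: one from the factor z, one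
      because the maximal degree was excluded.\<close>
    hence "degree p1 \<le> 2 * d" using Suc.prems(1) \<open>degree p \<noteq> 2 * Suc d\<close> by simp
    moreover have "\<exists>\<rho>>0. poly p1 z = of_real \<rho> * z ^ d" if "cmod z = 1" for z
      using Suc.prems(2)[OF that] that by (auto simp: p1)
    ultimately obtain q where "degree q \<le> d"
      "\<forall>z. cmod z = 1 \<longrightarrow> poly p1 z = of_real ((cmod (poly q z))\<^sup>2) * z ^ d"
      using Suc.IH by blast
    thus ?thesis by (intro exI[of _ q]) (auto simp: p1)
  next
    case False
    hence deg: "degree p = 2 * Suc d" using c0 by metis
    hence "\<not> constant (poly p)" by (simp add: constant_degree)
    then obtain r where r: "poly p r = 0" using fundamental_theorem_of_algebra by blast
    have r0: "r \<noteq> 0" using False r by (auto simp: poly_0_coeff_0)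
    \<comment> \<open>The mirror image of r in the unit circle, again a root by
      self-inversion.\<close>
    define r' where "r' = inverse (cnj r)"
    have r1: "cmod r \<noteq> 1" using Suc.prems(2)[of r] r r0 by auto
    have rr': "r \<noteq> r'"
    proof
      assume "r = r'"
      hence "r * cnj r = 1" using r0 unfolding r'_def by (metis complex_cnj_zero_iff left_inverse)
      hence "(cmod r)\<^sup>2 = 1" by (metis complex_norm_square of_real_eq_1_iff)
      thus False using r1 by (simp add: power2_eq_1_iff) (use norm_ge_zero[of r] in linarith)
    qed
    have "poly p r' = 0"
    proof -
      have "poly (map_poly cnj p) (cnj r) = 0" using r poly_cnj[of p r] by simp
      thus ?thesis using r0
        by (subst self) (simp add: poly_reflect_poly_nz r'_def)
    qed
    from r obtain p1 where p1: "p = [:- r, 1:] * p1" by (auto simp: poly_eq_0_iff_dvd)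
    with \<open>poly p r' = 0\<close> rr' have "poly p1 r' = 0" by simp
    then obtain p2 where p2: "p1 = [:- r', 1:] * p2" by (auto simp: poly_eq_0_iff_dvd)
    \<comment> \<open>On the circle (z - r) (z - r') = - r' z |z - r|^2, so absorbing the constant -
      r' leaves p = |z - r|^2 z p3 with p3 again positive after division by z^d.\<close>
    define p3 where "p3 = Polynomial.smult (- r') p2"
    have p2_0: "p2 \<noteq> 0" using p0 p1 p2 by auto
    have "degree p = 2 + degree p2" unfolding p1 p2 using p2_0
    by (simp add: degree_mult_eq del: mult_pCons_left)
    hence "degree p3 \<le> 2 * d" unfolding p3_def using deg degree_smult_le[of "- r'" p2] by simp
    have fac: "poly p z = of_real ((cmod (z - r))\<^sup>2) * z * poly p3 z" if "cmod z = 1" for z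
    proof -
      have "z * cnj z = 1" using that by (simp flip: complex_norm_square)
      hence "of_real ((cmod (z - r))\<^sup>2) * z = (z - r) * (1 - cnj r * z)"
        unfolding complex_norm_square by (simp add: algebra_simps)
      hence "of_real ((cmod (z - r))\<^sup>2) * z * poly p3 z
          = (z - r) * ((1 - cnj r * z) * (- r')) * poly p2 z"
        by (simp only: p3_def poly_smult mult_ac)
      also have "(1 - cnj r * z) * (- r') = z - r'"
        using r0 by (simp add: r'_def field_simps)
      also have "(z - r) * (z - r') * poly p2 z = poly p z"
        by (simp only: p1 p2 poly_mult) simp
      finally show ?thesis ..
    qed
    have "\<exists>\<rho>>0. poly p3 z = of_real \<rho> * z ^ d" if z: "cmod z = 1" for z
    proof -
      obtain \<rho> where \<rho>: "\<rho> > 0" "poly p z = of_real \<rho> * z ^ Suc d" using Suc.prems(2)[OF z] by blast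
      have "cmod (z - r) \<noteq> 0" "z \<noteq> 0" using z r1 by auto
      thus ?thesis using \<rho> fac[OF z]
        by (intro exI[of _ "\<rho> / (cmod (z - r))\<^sup>2"]) (auto simp: field_simps)
    qed
    with \<open>degree p3 \<le> 2 * d\<close> obtain q where q: "degree q \<le> d"
      "\<forall>z. cmod z = 1 \<longrightarrow> poly p3 z = of_real ((cmod (poly q z))\<^sup>2) * z ^ d"
      using Suc.IH by blast
    have "degree ([:- r, 1:] * q) \<le> Suc d"
      using degree_mult_le[of "[:- r, 1:]" q] q(1) by simp
    moreover have "poly p z = of_real ((cmod (poly ([:- r, 1:] * q) z))\<^sup>2) * z ^ Suc d" if "cmod z = 1" for z
    proof -
      have "poly ([:- r, 1:] * q) z = (z - r) * poly q z" by (simp only: poly_mult) simp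
      thus ?thesis using fac[OF that] q(2) that by (simp only: norm_mult) (simp add: power_mult_distrib)
    qed
    ultimately show ?thesis by blast
  qed
qed

lemma fejer_riesz:
  fixes n :: nat
  assumes n: "n > 0" and pos: "\<And>t. \<exists>\<rho>>0. trig_poly n c (cis t) = of_real \<rho>"
  shows "\<exists>q. degree q < n \<and> (\<forall>t. trig_poly n c (cis t) = of_real ((cmod (poly q (cis t)))\<^sup>2))"
proof -
  define d where "d = n - 1"
  have nd: "n = Suc d" using n by (simp add: d_def)
  \<comment> \<open>Multiplication by z^(n-1) clears the negative powers.\<close>
  define p where "p = (\<Sum>i\<le>2 * d. monom (c (int i - int d)) i)"
  have deg: "degree p \<le> 2 * d"
    unfolding p_def by (intro degree_sum_le) (auto intro: order.trans[OF degree_monom_le])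
  have p: "poly p z = trig_poly n c z * z ^ d" if "z \<noteq> 0" for z
  proof -
    have "poly p z = (\<Sum>i\<le>2 * d. c (int i - int d) * z ^ i)"
      by (simp add: p_def poly_sum poly_monom)
    also have "\<dots> = (\<Sum>j = - int n + 1..int n - 1. c j * z ^ nat (j + int d))"
      by (rule sum.reindex_bij_witness[of _ "\<lambda>j. nat (j + int d)" "\<lambda>i. int i - int d"])
         (auto simp: nd)
    also have "\<dots> = (\<Sum>j = - int n + 1..int n - 1. c j * z powi j * z ^ d)"
      using that by (intro sum.cong refl) (auto simp: nd power_int_add simp flip: power_int_of_nat)
    finally show ?thesis by (simp add: trig_poly_def sum_distrib_right)
  qed
  have "\<exists>\<rho>>0. poly p z = of_real \<rho> * z ^ d" if z: "cmod z = 1" for z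
  proof -
    have z0: "z \<noteq> 0" and zt: "z = cis (Arg z)" using z rcis_cmod_Arg[of z] by (auto simp: rcis_def)
    show ?thesis using p[OF z0] pos[of "Arg z"] zt by metis
  qed
  then obtain q where q: "degree q \<le> d"
    "\<And>z. cmod z = 1 \<Longrightarrow> poly p z = of_real ((cmod (poly q z))\<^sup>2) * z ^ d"
    using fejer_riesz_poly[OF deg] by blast
  have "trig_poly n c (cis t) = of_real ((cmod (poly q (cis t)))\<^sup>2)" for t
    using q(2)[of "cis t"] p[of "cis t"] by simp
  thus ?thesis using q(1) nd by (intro exI[of _ q]) auto
qed

text \<open>Sampling |q|^2 at frequency m retains exactly the products of coefficients whose indices
  differ by m.\<close>

lemma coeff_of_square_modulus:
  fixes n m :: nat
  assumes deg: "degree q < n" and m: "m < n"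
    and eq: "\<And>t. trig_poly n c (cis t) = of_real ((cmod (poly q (cis t)))\<^sup>2)"
  shows "c (int m) = (\<Sum>j<n. coeff q (j + m) * cnj (coeff q j))"
proof -
  define N where "N = 4 * n"
  let ?t = "\<lambda>s. 0 + 2 * pi * real s / real N"
  let ?q = "coeff q"
  have N: "N > 0" using m by (simp add: N_def)
  have dvd: "int N dvd int i - int j - int m \<longleftrightarrow> i = j + m" if "i < n" "j < n" for i j
  proof -
    have "\<bar>int i - int j\<bar> < int n" using that by linarith
    thus ?thesis using node_residue_unique[of N "int i - int j" "int m" n] m by (auto simp: N_def)
  qed
  have qt: "poly q (cis t) = (\<Sum>i<n. ?q i * cis (of_int (int i) * t))" for t
  proof -
    have "poly q z = (\<Sum>i<n. ?q i * z ^ i)" for z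
      unfolding poly_altdef using deg
      by (intro sum.mono_neutral_left) (auto simp: coeff_eq_0)
    thus ?thesis by (simp add: Complex.DeMoivre)
  qed
  have "of_nat N * c (int m) = (\<Sum>s<N. trig_poly n c (cis (?t s)) * cis (- (of_int (int m) * ?t s)))"
    using m by (subst trig_poly_nodes[OF N]) (auto intro: node_residue_unique[of N _ _ n] simp: N_def)
  also have "\<dots> = (\<Sum>s<N. \<Sum>j<n. \<Sum>i<n. ?q i * cnj (?q j) * cis (of_int (int i - int j - int m) * ?t s))"
  proof (intro sum.cong refl)
    fix s
    have "trig_poly n c (cis (?t s)) * cis (- (of_int (int m) * ?t s))
        = poly q (cis (?t s)) * cnj (poly q (cis (?t s))) * cis (- (of_int (int m) * ?t s))"
      unfolding eq complex_norm_square ..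
    also have "\<dots> = (\<Sum>j<n. \<Sum>i<n. ?q i * cis (of_int (int i) * ?t s) * cnj (?q j * cis (of_int (int j) * ?t s))
          * cis (- (of_int (int m) * ?t s)))"
      unfolding qt cnj_sum sum_product unfolding sum_distrib_right by (rule sum.swap)
    also have "\<dots> = (\<Sum>j<n. \<Sum>i<n. ?q i * cnj (?q j) * cis (of_int (int i - int j - int m) * ?t s))"
    proof (intro sum.cong refl)
      fix i j
      have "cis (of_int (int i) * ?t s) * cis (- (of_int (int j) * ?t s)) * cis (- (of_int (int m) * ?t s))
          = cis (of_int (int i - int j - int m) * ?t s)"
        unfolding cis_mult by (rule arg_cong[where f = cis]) (simp add: left_diff_distrib diff_divide_distrib)
      moreover have "a * x * (b * y) * w = a * b * (x * y * w)" for a b x y w :: complex by simp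
      ultimately show "?q i * cis (of_int (int i) * ?t s) * cnj (?q j * cis (of_int (int j) * ?t s))
          * cis (- (of_int (int m) * ?t s)) = ?q i * cnj (?q j) * cis (of_int (int i - int j - int m) * ?t s)"
        unfolding complex_cnj_mult cis_cnj by (simp only:)
    qed
    finally show "trig_poly n c (cis (?t s)) * cis (- (of_int (int m) * ?t s)) = \<dots>" .
  qed
  also have "\<dots> = (\<Sum>j<n. \<Sum>s<N. \<Sum>i<n. ?q i * cnj (?q j) * cis (of_int (int i - int j - int m) * ?t s))"
    by (rule sum.swap)
  also have "\<dots> = (\<Sum>j<n. \<Sum>i<n. \<Sum>s<N. ?q i * cnj (?q j) * cis (of_int (int i - int j - int m) * ?t s))"
    by (rule sum.cong[OF refl sum.swap])
  also have "\<dots> = (\<Sum>j<n. \<Sum>i<n. ?q i * cnj (?q j) * (\<Sum>s<N. cis (of_int (int i - int j - int m) * ?t s)))"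
    by (simp only: sum_distrib_left)
  also have "\<dots> = (\<Sum>j<n. \<Sum>i<n. if i = j + m then of_nat N * (?q (j + m) * cnj (?q j)) else 0)"
    unfolding sum_cis_nodes[OF N] using dvd by (intro sum.cong refl) auto
  \<comment> \<open>For j + m >= n no index i matches, but then \<open>coeff q (j + m)\<close> is 0
    as well.\<close>
  also have "\<dots> = (\<Sum>j<n. of_nat N * (?q (j + m) * cnj (?q j)))"
    using deg by (intro sum.cong refl) (auto simp: sum.delta coeff_eq_0)
  finally show ?thesis using N by (simp flip: sum_distrib_left)
qed

subsection \<open>Powers of the shift and the numerical radius\<close>

lemma shift_mat_carrier [simp]: "shift_mat n \<in> carrier_mat n n"
  by (auto simp: shift_mat_def mat_adjoint_def)

lemma shift_mat_pow_carrier [simp]: "shift_mat n ^\<^sub>m k \<in> carrier_mat n n"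
  by (simp add: pow_carrier_mat)

lemma shift_mat_entry:
  assumes "i < n" "j < n"
  shows "shift_mat n $$ (i, j) = (if i = Suc j then 1 else 0)"
  using assms by (auto simp: shift_mat_def mat_adjoint_def mat_of_rows_def)

lemma shift_mat_mult_vec:
  assumes "v \<in> carrier_vec n" "i < n"
  shows "(shift_mat n *\<^sub>v v) $ i = (if i = 0 then 0 else v $ (i - 1))"
proof -
  have "(shift_mat n *\<^sub>v v) $ i = (\<Sum>j = 0..<n. shift_mat n $$ (i, j) * v $ j)"
    using assms shift_mat_carrier[of n] by (simp add: scalar_prod_def del: shift_mat_carrier)
  also have "\<dots> = (\<Sum>j = 0..<n. if j = i - 1 then (if i = 0 then 0 else v $ (i - 1)) else 0)"
    using assms by (intro sum.cong) (auto simp: shift_mat_entry)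
  also have "\<dots> = (if i = 0 then 0 else v $ (i - 1))"
    using assms by (simp add: sum.delta)
  finally show ?thesis .
qed

lemma shift_mat_pow_mult_vec:
  assumes "v \<in> carrier_vec n" "i < n"
  shows "(shift_mat n ^\<^sub>m k *\<^sub>v v) $ i = (if k \<le> i then v $ (i - k) else 0)"
  using assms
proof (induction k arbitrary: v)
  case 0
  then show ?case using shift_mat_carrier[of n] by (simp del: shift_mat_carrier)
next
  case (Suc k)
  have w: "shift_mat n *\<^sub>v v \<in> carrier_vec n"
    by (rule mult_mat_vec_carrier[OF shift_mat_carrier Suc.prems(1)])
  have "shift_mat n ^\<^sub>m Suc k *\<^sub>v v = shift_mat n ^\<^sub>m k *\<^sub>v (shift_mat n *\<^sub>v v)"
    using assoc_mult_mat_vec[OF shift_mat_pow_carrier shift_mat_carrier Suc.prems(1)] by simp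
  thus ?case using Suc.IH[OF w Suc.prems(2)] Suc.prems
    by (auto simp: shift_mat_mult_vec)
qed

section \<open>The numerical radius and its quadratic form\<close>

lemma conjugate_scalar_prod_self:
  fixes v :: "complex vec"
  shows "v \<bullet>c v = of_real (\<Sum>i<dim_vec v. (cmod (v $ i))\<^sup>2)"
  by (simp add: scalar_prod_def complex_norm_square atLeast0LessThan del: of_real_power)

text \<open>A real supremum dominates its set only if the set is bounded. Entries of a unit vector
  have modulus at most 1, so the sum of the moduli of all matrix entries is a bound.\<close>

lemma bdd_above_numerical_range:
  fixes A :: "complex mat"
  assumes A: "A \<in> carrier_mat n n"
  shows "bdd_above ((\<lambda>v. cmod ((A *\<^sub>v v) \<bullet>c v)) ` {v \<in> carrier_vec (dim_row A). v \<bullet>c v = 1})"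
proof (rule bdd_aboveI2)
  fix v :: "complex Matrix.vec" assume "v \<in> {v \<in> carrier_vec (dim_row A). v \<bullet>c v = 1}"
  hence v: "v \<in> carrier_vec n" and n1: "v \<bullet>c v = 1" using A by auto
  have "(\<Sum>i<n. (cmod (v $ i))\<^sup>2) = 1"
    using n1 v unfolding conjugate_scalar_prod_self by (simp only: of_real_eq_1_iff carrier_vecD)
  hence le1: "cmod (v $ i) \<le> 1" if "i < n" for i
    using member_le_sum[of i "{..<n}" "\<lambda>i. (cmod (v $ i))\<^sup>2"] that
    by (simp add: power_le_one_iff abs_square_le_1)
  have "(A *\<^sub>v v) \<bullet>c v = (\<Sum>i<n. (\<Sum>j<n. A $$ (i, j) * v $ j) * cnj (v $ i))"
    using A v by (simp add: scalar_prod_def atLeast0LessThan)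
  also have "cmod \<dots> \<le> (\<Sum>i<n. \<Sum>j<n. cmod (A $$ (i, j)) * 1 * 1)"
    unfolding sum_distrib_right
    by (intro sum_norm_le, unfold norm_mult complex_mod_cnj) (intro mult_mono le1; simp)
  finally show "cmod ((A *\<^sub>v v) \<bullet>c v) \<le> (\<Sum>i<n. \<Sum>j<n. cmod (A $$ (i, j)) * 1 * 1)" .
qed

text \<open>Both sides are homogeneous of degree two in v, so a nonzero v can be normalized.\<close>

lemma numerical_radius_bound:
  fixes A :: "complex mat"
  assumes A: "A \<in> carrier_mat n n" and v: "v \<in> carrier_vec n"
  shows "cmod ((A *\<^sub>v v) \<bullet>c v) \<le> numerical_radius A * Re (v \<bullet>c v)"
proof (cases "v = 0\<^sub>v n")
  case True
  thus ?thesis using A by simp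
next
  case False
  define s where "s = (\<Sum>i<n. (cmod (v $ i))\<^sup>2)"
  have vv: "v \<bullet>c v = of_real s" using v by (simp add: s_def conjugate_scalar_prod_self)
  have "s \<noteq> 0" using conjugate_square_eq_0_vec[OF v] False vv by auto
  hence s: "s > 0" by (simp add: s_def sum_nonneg order_less_le)
  define a where "a = complex_of_real (1 / sqrt s)"
  have aa: "a * cnj a = of_real (1 / s)" using s by (simp add: a_def flip: of_real_mult)
  define w where "w = a \<cdot>\<^sub>v v"
  have w: "w \<in> carrier_vec n" using v by (simp add: w_def)
  have sc: "(B \<cdot>\<^sub>v x) \<bullet>c (B \<cdot>\<^sub>v y) = B * cnj B * (x \<bullet>c y)"
    if "x \<in> carrier_vec n" "y \<in> carrier_vec n" for B :: complex and x y
    using that by (simp add: conjugate_smult_vec)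
  have "w \<bullet>c w = 1" unfolding w_def sc[OF v v] aa vv using s by (simp flip: of_real_mult)
  hence "cmod ((A *\<^sub>v w) \<bullet>c w) \<le> numerical_radius A"
    unfolding numerical_radius_def using w A
    by (intro cSUP_upper bdd_above_numerical_range[OF A]) auto
  moreover have "(A *\<^sub>v w) \<bullet>c w = of_real (1 / s) * ((A *\<^sub>v v) \<bullet>c v)"
    unfolding w_def mult_mat_vec[OF A v] using sc[OF mult_mat_vec_carrier[OF A v] v, of a] aa by simp
  ultimately have "cmod ((A *\<^sub>v v) \<bullet>c v) / s \<le> numerical_radius A"
    using s by (simp add: norm_divide)
  thus ?thesis using s vv by (simp add: field_simps)
qed

text \<open>The form pairs v_(i-k) with the conjugate of v_i. Conjugating the coefficients of q in v
  therefore produces c_k and not its conjugate.\<close>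

lemma shift_mat_pow_form:
  assumes deg: "degree q < n"
  defines "v \<equiv> Matrix.vec n (\<lambda>j. cnj (coeff q j))"
  shows "(shift_mat n ^\<^sub>m k *\<^sub>v v) \<bullet>c v
           = (\<Sum>j<n. coeff q (j + k) * cnj (coeff q j))"
proof -
  have v: "v \<in> carrier_vec n" by (simp add: v_def)
  have vi: "v $ i = cnj (coeff q i)" if "i < n" for i using that by (simp add: v_def)
  have "(shift_mat n ^\<^sub>m k *\<^sub>v v) \<bullet>c v
      = (\<Sum>i<n. (shift_mat n ^\<^sub>m k *\<^sub>v v) $ i * cnj (v $ i))"
    using v by (simp add: scalar_prod_def atLeast0LessThan)
  also have "\<dots> = (\<Sum>i<n. if k \<le> i then cnj (coeff q (i - k)) * coeff q i else 0)"
    by (intro sum.cong refl) (simp add: shift_mat_pow_mult_vec[OF v] vi)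
  also have "\<dots> = (\<Sum>i\<in>{i. i < n \<and> k \<le> i}. cnj (coeff q (i - k)) * coeff q i)"
    by (rule sum.mono_neutral_cong_right) auto
  also have "\<dots> = (\<Sum>j\<in>{j. j + k < n}. coeff q (j + k) * cnj (coeff q j))"
    by (rule sum.reindex_bij_witness[of _ "\<lambda>j. j + k" "\<lambda>i. i - k"]) auto
  also have "\<dots> = (\<Sum>j<n. coeff q (j + k) * cnj (coeff q j))"
    using deg by (intro sum.mono_neutral_left) (auto intro!: coeff_eq_0)
  finally show ?thesis .
qed

lemma strictly_positive_trig_poly_numerical_radius:
  fixes n k l :: nat and a :: complex
  assumes pos: "\<And>t. \<exists>\<rho>>0. trig_poly n c (cis t) = of_real \<rho>"
    and k: "k < n" and l: "l < n"
  shows "cmod (c (int k) + a * c (int l))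
           \<le> Re (c 0) * numerical_radius (shift_mat n ^\<^sub>m k + a \<cdot>\<^sub>m (shift_mat n ^\<^sub>m l))"
proof -
  have n: "n > 0" using k by simp
  obtain q where deg: "degree q < n"
    and q: "\<And>t. trig_poly n c (cis t) = of_real ((cmod (poly q (cis t)))\<^sup>2)"
    using fejer_riesz[OF n pos] by blast
  define v where "v = Matrix.vec n (\<lambda>j. cnj (coeff q j))"
  let ?K = "shift_mat n ^\<^sub>m k" and ?L = "shift_mat n ^\<^sub>m l"
  have v: "v \<in> carrier_vec n" by (simp add: v_def)
  have form: "(shift_mat n ^\<^sub>m m *\<^sub>v v) \<bullet>c v = c (int m)" if "m < n" for m
    unfolding v_def shift_mat_pow_form[OF deg] using coeff_of_square_modulus[OF deg that q] ..
  \<comment> \<open>The case of exponent 0, where the power of the shift is the identity.\<close>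
  have "v \<bullet>c v = c 0"
    using form[OF n] v shift_mat_carrier[of n] by (simp del: shift_mat_carrier)
  have aL: "a \<cdot>\<^sub>m ?L \<in> carrier_mat n n" by simp
  have "(a \<cdot>\<^sub>m B) *\<^sub>v v = a \<cdot>\<^sub>v (B *\<^sub>v v)" if "B \<in> carrier_mat n n" for B
    using that v
    by (intro eq_vecI) (auto simp: smult_scalar_prod_distrib[of _ n] intro: row_carrier_vec)
  note aLv = this[OF shift_mat_pow_carrier, of l]
  have "(?K + a \<cdot>\<^sub>m ?L) *\<^sub>v v = ?K *\<^sub>v v + a \<cdot>\<^sub>v (?L *\<^sub>v v)"
    unfolding aLv[symmetric] by (rule add_mult_distrib_mat_vec[OF shift_mat_pow_carrier aL v])
  hence "((?K + a \<cdot>\<^sub>m ?L) *\<^sub>v v) \<bullet>c v = c (int k) + a * c (int l)"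
    using v form[OF k] form[OF l] mult_mat_vec_carrier[OF shift_mat_pow_carrier v]
    by (simp add: add_scalar_prod_distrib[of _ n] smult_scalar_prod_distrib[of _ n])
  moreover have "?K + a \<cdot>\<^sub>m ?L \<in> carrier_mat n n" using aL by simp
  ultimately show ?thesis
    using numerical_radius_bound[of "?K + a \<cdot>\<^sub>m ?L" n v] v \<open>v \<bullet>c v = c 0\<close>
    by (simp add: mult.commute)
qed

section \<open>From strictly positive to nonnegative polynomials\<close>

lemma trig_poly_add_const:
  assumes "n > 0"
  shows "trig_poly n (c(0 := c 0 + e)) z = trig_poly n c z + e"
proof -
  let ?J = "{- int n + 1..int n - 1}"
  have "trig_poly n (c(0 := c 0 + e)) z = (\<Sum>j\<in>?J. c j * z powi j + (if j = 0 then e else 0))"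
    unfolding trig_poly_def by (intro sum.cong) auto
  also have "\<dots> = trig_poly n c z + e"
    using assms by (simp add: trig_poly_def sum.distrib sum.delta)
  finally show ?thesis .
qed

lemma positive_trig_poly_numerical_radius:
  fixes n k l :: nat
  assumes pos: "positive_trig_poly n c" and k: "k < n" and l: "l < n"
  shows "\<exists>\<gamma>::real. cmod (c (int k)) + cmod (c (int l))
           \<le> Re (c 0) * numerical_radius
                (shift_mat n ^\<^sub>m k + exp (\<i> * of_real \<gamma>) \<cdot>\<^sub>m (shift_mat n ^\<^sub>m l))"
proof -
  \<comment> \<open>This rotation gives e^(i \<gamma>) c_l the argument of c_k, so the moduli add
    up.\<close>
  define \<gamma> where "\<gamma> = Arg (c (int k)) - Arg (c (int l))"
  define w where "w = numerical_radius (shift_mat n ^\<^sub>m k + cis \<gamma> \<cdot>\<^sub>m (shift_mat n ^\<^sub>m l))"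
  let ?S = "cmod (c (int k)) + cmod (c (int l))"
  have n: "n > 0" using k by simp
  have approx: "?S \<le> (Re (c 0) + e) * w" if e: "e > 0" for e
  proof -
    define c' where "c' = c(0 := c 0 + of_real e)"
    have "\<exists>\<rho>>0. trig_poly n c' (cis t) = of_real \<rho>" for t
    proof -
      have "trig_poly n c' (cis t) = of_real (Re (trig_poly n c (cis t)) + e)"
        unfolding c'_def trig_poly_add_const[OF n] of_real_add
        by (subst positive_trig_poly_cis(1)[OF pos]) simp
      thus ?thesis using positive_trig_poly_cis(2)[OF pos, of t] e
        by (intro exI[of _ "Re (trig_poly n c (cis t)) + e"]) simp
    qed
    from strictly_positive_trig_poly_numerical_radius[OF this k l, of "cis \<gamma>"]
    have bound: "cmod (c' (int k) + cis \<gamma> * c' (int l)) \<le> (Re (c 0) + e) * w"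
      by (simp add: w_def c'_def)
    \<comment> \<open>Needed when k or l is 0: as c_0 >= 0, with \<open>Arg 0 = 0\<close> by
      convention, adding e leaves its argument unchanged and only increases its modulus.\<close>
    have Arg0: "Arg (c 0) = 0"
      using positive_trig_poly_coeff_0[OF pos n] by (metis Arg_of_real not_less)
    have polar: "\<exists>r\<ge>cmod (c (int m)). c' (int m) = of_real r * cis (Arg (c (int m)))" for m
    proof (cases "m = 0")
      case True
      have "c' 0 = of_real (Re (c 0) + e)" "cmod (c 0) = Re (c 0)"
        using positive_trig_poly_coeff_0[OF pos n] by (auto simp: c'_def complex_eq_iff cmod_eq_Re)
      thus ?thesis using True Arg0 e by (intro exI[of _ "Re (c 0) + e"]) simp
    next
      case False
      thus ?thesis using rcis_cmod_Arg[of "c (int m)"]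
        by (intro exI[of _ "cmod (c (int m))"]) (simp add: c'_def rcis_def)
    qed
    obtain r where r: "r \<ge> cmod (c (int k))" "c' (int k) = of_real r * cis (Arg (c (int k)))"
      using polar by blast
    obtain s where s: "s \<ge> cmod (c (int l))" "c' (int l) = of_real s * cis (Arg (c (int l)))"
      using polar by blast
    have "cis \<gamma> * c' (int l) = of_real s * cis (Arg (c (int k)))"
      unfolding s(2) by (simp add: mult.left_commute[of "cis \<gamma>"] cis_mult \<gamma>_def)
    hence "c' (int k) + cis \<gamma> * c' (int l) = of_real (r + s) * cis (Arg (c (int k)))"
      by (simp add: r(2) distrib_right)
    hence "cmod (c' (int k) + cis \<gamma> * c' (int l)) = \<bar>r + s\<bar>"
      by (simp only: norm_mult norm_of_real norm_cis mult_1_right)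
    with bound r(1) s(1) show ?thesis by linarith
  qed
  have "((\<lambda>e. (Re (c 0) + e) * w) \<longlongrightarrow> (Re (c 0) + 0) * w) (at_right 0)"
    by (intro tendsto_intros)
  moreover have "eventually (\<lambda>e. ?S \<le> (Re (c 0) + e) * w) (at_right 0)"
    by (rule eventually_mono[OF eventually_at_right_less]) (rule approx)
  ultimately have "?S \<le> (Re (c 0) + 0) * w"
    by (rule tendsto_lowerbound) simp
  thus ?thesis by (intro exI[of _ \<gamma>]) (simp add: w_def cis_conv_exp)
qed

theorem theorem5p4:
  fixes n k l :: nat and c :: "int \<Rightarrow> complex"
  assumes "n \<ge> 2"
    and "positive_trig_poly n c"
    and "k \<in> {0..n - 1}" and "l \<in> {0..n - 1}" and "k \<noteq> l"
  shows "(\<exists>\<gamma>::real. cmod (c (int k)) + cmod (c (int l))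
            \<le> Re (c 0) * numerical_radius
                 (shift_mat n ^\<^sub>m k + exp (\<i> * of_real \<gamma>) \<cdot>\<^sub>m (shift_mat n ^\<^sub>m l)))
       \<and> cmod (c (int k)) + cmod (c (int l))
            \<le> Re (c 0)
              * sqrt (1 + cos (pi / (of_int \<lfloor>(real n - 1) / (real k + real l)\<rfloor> + 2)))
              * sqrt (1 + cos (pi / (of_int \<lfloor>(real n - 1) / \<bar>real k - real l\<bar>\<rfloor> + 2)))"
proof
  have n: "n > 0" and k: "k < n" and l: "l < n" using assms(1,3,4) by auto
  show "\<exists>\<gamma>::real. cmod (c (int k)) + cmod (c (int l))
            \<le> Re (c 0) * numerical_radius
                 (shift_mat n ^\<^sub>m k + exp (\<i> * of_real \<gamma>) \<cdot>\<^sub>m (shift_mat n ^\<^sub>m l))"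
    by (rule positive_trig_poly_numerical_radius[OF assms(2) k l])
  \<comment> \<open>The floor of a real quotient of naturals is natural division;
    \<open>n > 0\<close> ensures that \<open>n - 1\<close> is not truncated.\<close>
  have floor: "of_int \<lfloor>(real n - 1) / real m\<rfloor> = real ((n - 1) div m)" for m
    using floor_divide_of_nat_eq[of "n - 1" m, where 'a = real] n by (simp add: of_nat_diff)
  \<comment> \<open>The bound is symmetric in the two indices, so it suffices to treat one order, in
    which their difference is a natural number.\<close>
  have main: "cmod (c (int i)) + cmod (c (int j))
            \<le> Re (c 0)
              * sqrt (1 + cos (pi / (of_int \<lfloor>(real n - 1) / (real i + real j)\<rfloor> + 2)))
              * sqrt (1 + cos (pi / (of_int \<lfloor>(real n - 1) / \<bar>real i - real j\<bar>\<rfloor> + 2)))"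
    if "j < i" "i < n" for i j
  proof -
    have "real i + real j = real (i + j)" "\<bar>real i - real j\<bar> = real (i - j)"
      using that by (auto simp: of_nat_diff)
    thus ?thesis using positive_trig_poly_two_coeffs[OF assms(2) that] by (simp only: floor)
  qed
  show "cmod (c (int k)) + cmod (c (int l))
            \<le> Re (c 0)
              * sqrt (1 + cos (pi / (of_int \<lfloor>(real n - 1) / (real k + real l)\<rfloor> + 2)))
              * sqrt (1 + cos (pi / (of_int \<lfloor>(real n - 1) / \<bar>real k - real l\<bar>\<rfloor> + 2)))"
    using main[of l k] main[of k l] assms(5) k l
    by (cases "l < k") (simp_all add: add.commute abs_minus_commute)
qed

end
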